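(* We have $\widehat{\sigma}_2 < 657$.
   Context: For $\mathbf{c}\in\mathbb{R}^2$, the unit disk with center $\mathbf{c}$ is the open disk $D_{\mathbf{c}}=\{\mathbf{x}\in\mathbb{R}^2 : \|\mathbf{x}-\mathbf{c}\|<1\}$ (Euclidean norm). For a finite point set $X\subset\mathbb{R}^2$, a family $\mathscr{D}$ of (not necessarily disjoint) unit disks is an exact cover of $X$ if each point $\mathbf{x}\in X$ is contained in exactly one disk $D\in\mathscr{D}$. Let $\widehat{\sigma}_2$ be the largest $n\in\mathbb{N}$ such that every set of $n$ points in the plane $\mathbb{R}^2$ has an exact cover by unit disks. *)

theory Defs
  imports "HOL-Analysis.Analysis"
begin

definition unit_disk :: "real ^ 2 \<Rightarrow> (real ^ 2) set" where
  "unit_disk c = ball c 1"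

definition exact_cover :: "(real ^ 2) set set \<Rightarrow> (real ^ 2) set \<Rightarrow> bool" where
  "exact_cover \<D> X \<longleftrightarrow>
     \<D> \<subseteq> range unit_disk \<and> (\<forall>x\<in>X. \<exists>!D. D \<in> \<D> \<and> x \<in> D)"

definition all_exactly_coverable :: "nat \<Rightarrow> bool" where
  "all_exactly_coverable n \<longleftrightarrow>
     (\<forall>X. finite X \<and> card X = n \<longrightarrow> (\<exists>\<D>. exact_cover \<D> X))"

text \<open>The operator \<^const>\<open>Greatest\<close> is total, so \<open>sigma_hat_2\<close> is meaningful only if a largest
  such \<open>n\<close> exists; statements about it should assert this as well.\<close>

definition sigma_hat_2 :: nat where
  "sigma_hat_2 = (GREATEST n. all_exactly_coverable n)"

end

theory Submission
  imports Defs
begin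

text \<open>
  Scale the plane by \<open>19/2\<close>, so that unit disks become disks of radius \<open>r = 19/2\<close>, and identify
  it with the complex numbers. The bad configuration is \<open>grid\<close>, the \<open>657\<close> points of the
  integer lattice at distance less than \<open>sqrt 208\<close> from the origin. These points are so dense that
  an exact cover would have to be nearly a covering and nearly a packing at the same time, and
  disks of equal size cannot do both: to leave no gap along its boundary, a disk needs neighbours at
  angular distances of less than sixty degrees, and such neighbours overlap each other.

  In detail, suppose that \<open>C\<close> is the set of centres of an exact cover, and let \<open>c\<close> be the
  centre of the disk that contains the origin. For a unit vector \<open>w\<close> whose direction is within
  thirty degrees of that from \<open>c\<close> to the origin, look at two points on the ray from \<open>c\<close> along \<open>w\<close>:
  \<open>y = c + \<rho> w\<close> with \<open>\<rho> = r + 0.7072\<close>, just outside the disk, and \<open>z = c + Z w\<close> with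
  \<open>Z = 13.71\<close>, farther out, where any two disks that leave no gap at \<open>y\<close> would overlap.

  \<^item> Every point of the plane has a lattice point within \<open>0.7072 > sqrt (1/2)\<close>. The disk that
    contains a lattice point near \<open>y\<close> has its centre \<open>d\<close> closer to \<open>y\<close> than \<open>\<rho>\<close>, and
    hence \<open>d\<close> differs from \<open>c\<close>.
  \<^item> The intersection of the disks around \<open>c\<close> and \<open>d\<close> contains no point of the grid, so it is thin:
    \<open>|c - d| > 17.965\<close>. This is \<open>lens_contains_lattice_point\<close>, the main estimate.
  \<^item> The last two inequalities force \<open>|d - z| < r - 0.7072\<close> (\<open>disk_beyond_tangent_forced\<close>), so the
    disk around \<open>d\<close> contains the lattice point nearest to \<open>z\<close>. Only one disk does, so \<open>d\<close> is
    determined by \<open>w\<close>.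

  Thus the arc of all such \<open>y\<close> is covered by open disks of radius \<open>\<rho>\<close> that are disjoint on the
  arc. As the arc is connected, a single \<open>d\<close> serves the whole of it. But an arc of sixty degrees lies in
  the disk of radius \<open>\<rho>\<close> around \<open>d\<close> only if \<open>|c - d| < sqrt 3 * \<rho> < 17.7\<close>, a contradiction.

  The argument uses only lattice points of norm at most \<open>Z + 0.7072 < 14.42 < sqrt 208\<close>. There is
  little slack: for a smaller \<open>r\<close> the lattice is too coarse compared with the disks and the
  inequalities need a larger \<open>Z\<close>, while for a larger \<open>r\<close> too many lattice points are close enough
  to the origin to be involved.
\<close>

section \<open>Points of the integer lattice in a disk\<close>

definition lattice_points :: "complex set" where
  "lattice_points = {Complex (of_int i) (of_int j) |i j. True}"

definition grid :: "complex set" where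
  "grid = {p \<in> lattice_points. (cmod p)\<^sup>2 < 208}"

lemma abs_diff_round_le:
  fixes x :: real
  shows "\<bar>x - of_int (round x)\<bar> \<le> 1/2"
  using of_int_round_abs_le[of x] by (simp add: abs_minus_commute)

lemma lattice_point_near:
  obtains p where "p \<in> lattice_points" "dist z p < 7072/10000"
proof -
  define p where "p = Complex (of_int (round (Re z))) (of_int (round (Im z)))"
  have "(Re z - of_int (round (Re z)))\<^sup>2 \<le> (1/2)\<^sup>2"
       "(Im z - of_int (round (Im z)))\<^sup>2 \<le> (1/2)\<^sup>2"
    using abs_diff_round_le by (auto simp: abs_le_square_iff[symmetric])
  then have "(dist z p)\<^sup>2 < (7072/10000)\<^sup>2"
    unfolding dist_complex_def cmod_power2 p_def by (simp add: power2_eq_square)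
  then have "dist z p < 7072/10000" by (rule power2_less_imp_less) simp
  then show ?thesis using that[of p] unfolding p_def lattice_points_def by blast
qed

lemma mem_gridI:
  assumes "p \<in> lattice_points" "cmod p < 1442/100"
  shows "p \<in> grid"
proof -
  have "(cmod p)\<^sup>2 < (1442/100)\<^sup>2" using assms by (intro power_strict_mono) auto
  then show ?thesis using assms unfolding grid_def by (simp add: power2_eq_square)
qed

text \<open>The grid is counted column by column: the table lists, for \<open>|i| = 0, ..., 14\<close>, the largest
  \<open>j\<close> with \<open>i\<^sup>2 + j\<^sup>2 < 208\<close>.\<close>

lemma card_grid: "finite grid" "card grid \<le> 657"
proof -
  define b :: "int \<Rightarrow> int" where
    "b i = [14,14,14,14,13,13,13,12,11,11,10,9,7,6,3] ! nat \<bar>i\<bar>" for i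
  define S where "S = (SIGMA i:{-14..14}. {- b i..b i})"
  have up: "{-14..14::int} = set [-14..14]" by (simp only: set_upto)
  have b: "0 \<le> b i \<and> 208 - i\<^sup>2 \<le> (b i + 1)\<^sup>2" if "i \<in> {-14..14}" for i
  proof -
    have "\<forall>i\<in>set [-14..14]. 0 \<le> b i \<and> 208 - i\<^sup>2 \<le> (b i + 1)\<^sup>2" unfolding b_def by code_simp
    with that show ?thesis unfolding up by blast
  qed
  have "grid \<subseteq> (\<lambda>(i, j). Complex (of_int i) (of_int j)) ` S"
  proof
    fix p assume "p \<in> grid"
    then obtain i j where p: "p = Complex (of_int i) (of_int j)" "(cmod p)\<^sup>2 < 208"
      unfolding grid_def lattice_points_def by blast
    then have "real_of_int (i\<^sup>2 + j\<^sup>2) < real_of_int 208" unfolding cmod_power2 by simp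
    then have ij: "i\<^sup>2 + j\<^sup>2 < 208" by (simp only: of_int_less_iff)
    have "\<bar>i\<bar>\<^sup>2 < 225" using ij zero_le_power2[of j] unfolding power2_abs by linarith
    then have "\<bar>i\<bar>\<^sup>2 < 15\<^sup>2" by simp
    then have "\<bar>i\<bar> < 15" by (rule power2_less_imp_less) simp
    then have i: "i \<in> {-14..14}" by auto
    have "\<bar>j\<bar>\<^sup>2 < (b i + 1)\<^sup>2" using b[OF i] ij by simp
    then have "\<bar>j\<bar> < b i + 1" by (rule power2_less_imp_less) (use b[OF i] in simp)
    then show "p \<in> (\<lambda>(i, j). Complex (of_int i) (of_int j)) ` S"
      using i p by (auto simp: S_def intro!: image_eqI[of _ _ "(i, j)"])
  qed
  moreover have "finite S" unfolding S_def by simp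
  moreover have "card S \<le> 657"
  proof -
    have "card S = (\<Sum>i\<in>{-14..14}. card {- b i..b i})" unfolding S_def by simp
    also have "\<dots> = (\<Sum>i\<in>{-14..14}. nat (2 * b i + 1))" by (intro sum.cong) auto
    also have "\<dots> = sum_list (map (\<lambda>i. nat (2 * b i + 1)) [-14..14])"
      unfolding up by (intro sum.distinct_set_conv_list) simp
    also have "\<dots> = 657" unfolding b_def by code_simp
    finally show ?thesis by simp
  qed
  ultimately show "finite grid" "card grid \<le> 657"
    by (auto intro: finite_surj dest: surj_card_le[rotated])
qed

section \<open>Lattice points in the intersection of two disks\<close>

text \<open>In the application \<open>A\<close> and \<open>k * A\<close> are the absolute coordinates of half the vector between the
  centres. The left-hand side without \<open>k\<close> is \<open>A\<^sup>2 + A + 1/2\<close>, which is \<open>90.17\<close> for the largest \<open>A\<close>; this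
  leaves a margin of \<open>0.08\<close> below \<open>(19/2)\<^sup>2 = 90.25\<close>. A positive \<open>k\<close> adds \<open>k/2 + k\<^sup>2/4\<close> but
  lowers the bound on \<open>A\<close> by about \<open>4 * k\<^sup>2\<close>, so that the net gain stays below the margin.\<close>

lemma lens_inequality:
  fixes A k :: real
  assumes "0 < A" "0 \<le> k" "k \<le> 1" and le: "A\<^sup>2 * (1 + k\<^sup>2) \<le> (3593/400)\<^sup>2"
  shows "A\<^sup>2 * (1 + k\<^sup>2) + 1/4 + (1 + k)\<^sup>2 / 4 + A < (19/2)\<^sup>2"
proof -
  have square: "(3593/400)\<^sup>2 \<le> (8069/100 :: real)" by (simp add: power2_eq_square)
  have "A + k/2 + k\<^sup>2/4 + 1/2 < 956/100"
  \<comment> \<open>For small \<open>A\<close> the crude bound \<open>k \<le> 1\<close> is good enough. Otherwise \<open>18 * A \<le> A\<^sup>2 + 81\<close>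
    linearises \<open>A\<close> at \<open>9\<close>, close to its maximum, and \<open>k \<le> 5 * k\<^sup>2 + 1/20\<close> replaces \<open>k\<close> by
    a multiple of \<open>k\<^sup>2\<close>, with equality at \<open>k = 1/10\<close>, close to the worst case.\<close>
  proof (cases "A \<le> 8")
    case True
    have "k\<^sup>2 \<le> 1" using assms by (simp add: power_le_one)
    then show ?thesis using True assms by simp
  next
    case False
    then have "8\<^sup>2 \<le> A\<^sup>2" by (intro power_mono) auto
    then have "64 * k\<^sup>2 \<le> A\<^sup>2 * k\<^sup>2" by (intro mult_right_mono) auto
    then have 1: "A\<^sup>2 \<le> (3593/400)\<^sup>2 - 64 * k\<^sup>2" using le by (simp add: algebra_simps)
    have "0 \<le> (A - 9)\<^sup>2" by simp
    then have "18 * A \<le> A\<^sup>2 + 81" by (simp add: power2_eq_square algebra_simps)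
    then have 2: "18 * A \<le> (3593/400)\<^sup>2 - 64 * k\<^sup>2 + 81" using 1 by linarith
    have "0 \<le> (k - 1/10)\<^sup>2" by simp
    then have "k \<le> 5 * k\<^sup>2 + 1/20" by (simp add: power2_eq_square algebra_simps)
    then show ?thesis using 2 using square zero_le_power2[of k] by linarith
  qed
  moreover have "(1 + k)\<^sup>2 / 4 = 1/4 + k/2 + k\<^sup>2/4" by (simp add: power2_eq_square field_simps)
  moreover have "(956/100 :: real) + 8069/100 \<le> (19/2)\<^sup>2" by (simp add: power2_eq_square)
  ultimately show ?thesis using le square by linarith
qed

text \<open>Let the origin be the midpoint of the two centres \<open>(g, h)\<close> and \<open>(-g, -h)\<close>. The disks meet in a
  lens whose long axis is perpendicular to \<open>(g, h)\<close> and, as \<open>|g| \<le> |h|\<close>, closer to horizontal than to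
  vertical. The lattice column nearest to the midpoint is at some signed horizontal distance \<open>f\<close>, and
  it meets the axis at height \<open>- f * g / h\<close>; the lattice point of that column nearest to the axis
  lies off the axis by some signed vertical distance \<open>s\<close>. The deviation along the axis hardly
  matters, since it enters the squared distances to the centres only by its square, and the
  deviation across the axis is at most half a unit. This is better than
  taking the nearest lattice point, which may deviate by \<open>sqrt (1/2)\<close> across the axis.\<close>

lemma lens_column:
  fixes g h f s :: real
  assumes "\<bar>g\<bar> \<le> \<bar>h\<bar>" "h \<noteq> 0" "g\<^sup>2 + h\<^sup>2 \<le> (3593/400)\<^sup>2" "\<bar>f\<bar> \<le> 1/2" "\<bar>s\<bar> \<le> 1/2"
  shows "(f - g)\<^sup>2 + ((s - f * g / h) - h)\<^sup>2 < (19/2)\<^sup>2"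
    and "(f + g)\<^sup>2 + ((s - f * g / h) + h)\<^sup>2 < (19/2)\<^sup>2"
    and "f\<^sup>2 + (s - f * g / h)\<^sup>2 \<le> 5/4"
proof -
  define k where "k = \<bar>g\<bar> / \<bar>h\<bar>"
  define e where "e = s - f * g / h"
  have k: "0 \<le> k" "k \<le> 1" using assms by (auto simp: k_def divide_le_eq)
  have g: "\<bar>g\<bar> = k * \<bar>h\<bar>" using assms by (simp add: k_def)
  have "g\<^sup>2 = k\<^sup>2 * h\<^sup>2" using g by (metis power2_abs power_mult_distrib)
  then have gh: "\<bar>h\<bar>\<^sup>2 * (1 + k\<^sup>2) = g\<^sup>2 + h\<^sup>2" by (simp add: algebra_simps)
  have f2: "f\<^sup>2 \<le> 1/4" using power_mono[OF assms(4), of 2] by (simp add: power2_eq_square)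
  have "\<bar>f * g / h\<bar> = \<bar>f\<bar> * k" by (simp add: k_def abs_mult)
  also have "\<dots> \<le> 1/2 * k" using assms k by (intro mult_right_mono) auto
  finally have "\<bar>f * g / h\<bar> \<le> 1/2 * k" .
  moreover have "\<bar>e\<bar> \<le> \<bar>s\<bar> + \<bar>f * g / h\<bar>" unfolding e_def by (rule abs_triangle_ineq4)
  ultimately have "\<bar>e\<bar> \<le> (1 + k) / 2" using assms(5) by argo
  from power_mono[OF this, of 2] have e2: "e\<^sup>2 \<le> (1 + k)\<^sup>2 / 4"
    by (simp add: power_divide)
  have "(1 + k)\<^sup>2 \<le> 2\<^sup>2" using k by (intro power_mono) auto
  then show "f\<^sup>2 + (s - f * g / h)\<^sup>2 \<le> 5/4" using f2 e2 unfolding e_def by simp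
  have eh: "f * g + e * h = s * h" using assms unfolding e_def by (simp add: field_simps)
  have "\<bar>s * h\<bar> \<le> 1/2 * \<bar>h\<bar>" unfolding abs_mult using assms by (intro mult_right_mono) auto
  then have sh: "2 * (s * h) \<le> \<bar>h\<bar>" "- 2 * (s * h) \<le> \<bar>h\<bar>" by (simp_all add: abs_le_iff)
  have main: "g\<^sup>2 + h\<^sup>2 + 1/4 + (1 + k)\<^sup>2 / 4 + \<bar>h\<bar> < (19/2)\<^sup>2"
    using lens_inequality[of "\<bar>h\<bar>" k] k assms unfolding gh by simp
  have "(f - g)\<^sup>2 + (e - h)\<^sup>2 = g\<^sup>2 + h\<^sup>2 + f\<^sup>2 + e\<^sup>2 - 2 * (s * h)"
    unfolding eh[symmetric] by (simp add: power2_eq_square algebra_simps)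
  also have "\<dots> < (19/2)\<^sup>2" using main f2 e2 sh by linarith
  finally show "(f - g)\<^sup>2 + ((s - f * g / h) - h)\<^sup>2 < (19/2)\<^sup>2" unfolding e_def .
  have "(f + g)\<^sup>2 + (e + h)\<^sup>2 = g\<^sup>2 + h\<^sup>2 + f\<^sup>2 + e\<^sup>2 + 2 * (s * h)"
    unfolding eh[symmetric] by (simp add: power2_eq_square algebra_simps)
  also have "\<dots> < (19/2)\<^sup>2" using main f2 e2 sh by linarith
  finally show "(f + g)\<^sup>2 + ((s - f * g / h) + h)\<^sup>2 < (19/2)\<^sup>2" unfolding e_def .
qed

text \<open>The distance bound \<open>3593/200 = 17.965\<close> falls short of the diameter \<open>19\<close> by little more than \<open>1\<close>, the
  spacing of the lattice: lenses of width at least \<open>1.035\<close> are hit.\<close>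

lemma lens_contains_lattice_point_flat:
  assumes "u \<noteq> v" "cmod (u - v) \<le> 3593/200" and flat: "\<bar>Re (u - v)\<bar> \<le> \<bar>Im (u - v)\<bar>"
  obtains p where "p \<in> lattice_points" "dist u p < 19/2" "dist v p < 19/2"
    "dist ((u + v) / 2) p \<le> 9/8"
proof -
  define m where "m = (u + v) / 2"
  define g where "g = Re (u - v) / 2"
  define h where "h = Im (u - v) / 2"
  have u: "u = Complex (Re m + g) (Im m + h)" and v: "v = Complex (Re m - g) (Im m - h)"
    by (simp_all add: m_def g_def h_def complex_eq_iff field_simps)
  have gh: "\<bar>g\<bar> \<le> \<bar>h\<bar>" using flat by (simp add: g_def h_def)
  have h0: "h \<noteq> 0" using gh \<open>u \<noteq> v\<close> by (auto simp: u v)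
  have "(cmod (u - v))\<^sup>2 \<le> (3593/200)\<^sup>2" using assms by (intro power_mono) auto
  then have le: "g\<^sup>2 + h\<^sup>2 \<le> (3593/400)\<^sup>2"
    unfolding cmod_power2 g_def h_def by (simp add: power_divide)
  define i where "i = round (Re m)"
  define f where "f = of_int i - Re m"
  define j where "j = round (Im m - f * g / h)"
  define s where "s = of_int j - (Im m - f * g / h)"
  have fs: "\<bar>f\<bar> \<le> 1/2" "\<bar>s\<bar> \<le> 1/2"
    using abs_diff_round_le[of "Re m"] abs_diff_round_le[of "Im m - f * g / h"]
    unfolding f_def i_def s_def j_def by linarith+
  define p where "p = Complex (of_int i) (of_int j)"
  have p: "p = Complex (Re m + f) (Im m + (s - f * g / h))"
    by (simp add: p_def f_def s_def)
  note col = lens_column[OF gh h0 le fs]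
  have "p - u = Complex (f - g) ((s - f * g / h) - h)"
    by (simp add: u p complex_eq_iff)
  then have "(dist u p)\<^sup>2 < (19/2)\<^sup>2"
    using col(1) unfolding dist_norm norm_minus_commute[of u p] by (simp add: cmod_power2)
  then have 1: "dist u p < 19/2" by (rule power2_less_imp_less) simp
  have "p - v = Complex (f + g) ((s - f * g / h) + h)"
    by (simp add: v p complex_eq_iff)
  then have "(dist v p)\<^sup>2 < (19/2)\<^sup>2"
    using col(2) unfolding dist_norm norm_minus_commute[of v p] by (simp add: cmod_power2)
  then have 2: "dist v p < 19/2" by (rule power2_less_imp_less) simp
  have "(dist m p)\<^sup>2 \<le> 5/4"
    using col(3) unfolding dist_norm norm_minus_commute[of m p] by (simp add: cmod_power2 p)
  also have "5/4 \<le> (9/8::real)\<^sup>2" by (simp add: power2_eq_square)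
  finally have 3: "dist m p \<le> 9/8" by (rule power2_le_imp_le) simp
  show ?thesis using that[of p] 1 2 3 unfolding m_def p_def lattice_points_def by blast
qed

lemma lens_contains_lattice_point:
  assumes "u \<noteq> v" "cmod (u - v) \<le> 3593/200"
  obtains p where "p \<in> lattice_points" "dist u p < 19/2" "dist v p < 19/2"
    "dist ((u + v) / 2) p \<le> 9/8"
proof (cases "\<bar>Re (u - v)\<bar> \<le> \<bar>Im (u - v)\<bar>")
  case True
  then show ?thesis using lens_contains_lattice_point_flat[OF assms] that by blast
next
  case False
  define T where "T z = Complex (Im z) (Re z)" for z
  have TT: "T (T z) = z" for z by (simp add: T_def)
  have dT: "dist (T x) (T y) = dist x y" for x y
    by (simp add: T_def dist_complex_def cmod_def add.commute)
  have Tm: "T ((x + y) / 2) = (T x + T y) / 2" for x y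
    by (simp add: T_def complex_eq_iff)
  have "T u \<noteq> T v" using assms TT by metis
  moreover have "cmod (T u - T v) \<le> 3593/200" using assms dT[of u v] by (simp add: dist_norm)
  moreover have "\<bar>Re (T u - T v)\<bar> \<le> \<bar>Im (T u - T v)\<bar>" using False by (simp add: T_def)
  ultimately obtain p where p: "p \<in> lattice_points" "dist (T u) p < 19/2" "dist (T v) p < 19/2"
    "dist ((T u + T v) / 2) p \<le> 9/8"
    using lens_contains_lattice_point_flat by blast
  have "T p \<in> lattice_points" using p(1) unfolding lattice_points_def T_def by auto
  moreover have "dist x (T p) = dist (T x) p" for x using dT[of x "T p"] TT by simp
  ultimately show ?thesis using that[of "T p"] p Tm by simp
qed

section \<open>The neighbours of a disk\<close>

lemma norm_add_scaleR_unit_squared: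
  fixes a w :: "'a::real_inner"
  assumes "norm w = 1"
  shows "(norm (a + t *\<^sub>R w))\<^sup>2 = (norm a)\<^sup>2 + 2 * t * (a \<bullet> w) + t\<^sup>2"
proof -
  have "w \<bullet> w = 1" using assms by (simp add: dot_square_norm)
  then show ?thesis
    unfolding power2_norm_eq_inner
    by (simp add: inner_add_left inner_add_right inner_commute power2_eq_square algebra_simps)
qed

text \<open>Here \<open>a\<close> is the centre of a neighbour of the disk around \<open>0\<close>. With \<open>\<rho> = 10.2072\<close> the assumption
  \<open>near\<close> bounds \<open>a \<bullet> w\<close> below by \<open>|a|\<^sup>2 / (2 * \<rho>)\<close>, so that for \<open>Z = 13.71\<close>
  \<open>|a - Z w|\<^sup>2 < Z\<^sup>2 - |a|\<^sup>2 * (Z / \<rho> - 1)\<close>, which is decreasing in \<open>|a|\<close>. The conclusion is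
  the radius \<open>19/2\<close> reduced by \<open>0.7072\<close>, the distance within which a lattice point is sure to exist.\<close>

lemma disk_beyond_tangent_forced:
  fixes a w :: complex
  assumes w: "norm w = 1" and a: "3593/200 < norm a"
    and near: "dist a ((102072/10000) *\<^sub>R w) < 102072/10000"
  shows "dist a ((1371/100) *\<^sub>R w) < 87928/10000"
proof -
  have dist2: "(dist a (t *\<^sub>R w))\<^sup>2 = (norm a)\<^sup>2 - 2 * t * (a \<bullet> w) + t\<^sup>2" for t
    using norm_add_scaleR_unit_squared[OF w, of a "- t"] by (simp add: dist_norm)
  have "(dist a ((102072/10000) *\<^sub>R w))\<^sup>2 < (102072/10000)\<^sup>2"
    using near by (intro power_strict_mono) auto
  then have 1: "(norm a)\<^sup>2 < 2 * (102072/10000) * (a \<bullet> w)" unfolding dist2 by simp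
  have 2: "(3593/200)\<^sup>2 < (norm a)\<^sup>2" using a by (intro power_strict_mono) auto
  have "(dist a ((1371/100) *\<^sub>R w))\<^sup>2 < (87928/10000)\<^sup>2"
    using 1 2 unfolding dist2 by (simp add: power2_eq_square)
  then show ?thesis by (rule power2_less_imp_less) simp
qed

lemma grid_not_exactly_covered:
  assumes cover: "\<And>p. p \<in> grid \<Longrightarrow> \<exists>!c. c \<in> C \<and> dist c p < 19/2"
  shows False
proof -
  define \<rho> :: real where "\<rho> = 102072/10000"
  define Z :: real where "Z = 1371/100"
  have "0 \<in> lattice_points" unfolding lattice_points_def
    by (auto simp: complex_eq_iff intro!: exI[of _ 0])
  then have "0 \<in> grid" by (intro mem_gridI) auto
  then obtain c where c: "c \<in> C" "cmod c < 19/2" using cover[of 0] by (auto simp: dist_norm)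
  \<comment> \<open>The direction from \<open>c\<close> to the origin; any direction will do if \<open>c = 0\<close>.\<close>
  define u where "u = (if c = 0 then 1 else - sgn c)"
  have u: "norm u = 1" by (simp add: u_def norm_sgn)
  have cu: "c = (- cmod c) *\<^sub>R u" by (simp add: u_def sgn_div_norm)
  define S where "S = {- pi/6..pi/6}"
  define w where "w \<phi> = u * cis \<phi>" for \<phi>
  define y where "y \<phi> = c + \<rho> *\<^sub>R w \<phi>" for \<phi>
  have norm_w: "norm (w \<phi>) = 1" for \<phi> by (simp add: w_def norm_mult u)
  have "u \<bullet> w \<phi> = cos \<phi>" for \<phi>
  proof -
    have "(Re u)\<^sup>2 + (Im u)\<^sup>2 = 1" using u cmod_power2[of u] by simp
    moreover have "u \<bullet> w \<phi> = ((Re u)\<^sup>2 + (Im u)\<^sup>2) * cos \<phi>"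
      by (simp add: w_def inner_complex_def power2_eq_square algebra_simps)
    ultimately show ?thesis by simp
  qed
  then have cw: "c \<bullet> w \<phi> = - cmod c * cos \<phi>" for \<phi>
    by (subst cu) (simp only: inner_scaleR_left)
  \<comment> \<open>A rational substitute for \<open>cos (pi/6) = sqrt 3 / 2\<close>.\<close>
  have cos_ge: "4/5 \<le> cos \<phi>" if "\<phi> \<in> S" for \<phi>
  proof -
    have "cos (pi/6) \<le> cos \<bar>\<phi>\<bar>"
      using that unfolding S_def by (intro cos_monotone_0_pi_le) auto
    moreover have "8/5 \<le> sqrt 3" by (rule real_le_rsqrt) (simp add: power2_eq_square)
    ultimately show ?thesis by (simp add: cos_30)
  qed
  have norm_sq: "(cmod (c + t *\<^sub>R w \<phi>))\<^sup>2 \<le> (cmod c)\<^sup>2 - 8/5 * t * cmod c + t\<^sup>2"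
    if "\<phi> \<in> S" "0 \<le> t" for t \<phi>
  proof -
    have "(cmod (c + t *\<^sub>R w \<phi>))\<^sup>2 = (cmod c)\<^sup>2 - 2 * (t * cmod c) * cos \<phi> + t\<^sup>2"
      using norm_add_scaleR_unit_squared[OF norm_w, of c t \<phi>] by (simp add: cw)
    moreover have "(t * cmod c) * (4/5) \<le> (t * cmod c) * cos \<phi>"
      using that cos_ge by (intro mult_left_mono) auto
    ultimately show ?thesis by simp
  qed
  \<comment> \<open>Going from \<open>c\<close> back towards the origin for a distance of at least \<open>6\<close> leads to a point that
    is not farther from the origin than from \<open>c\<close>. This keeps the points \<open>y \<phi>\<close> and \<open>c + Z w\<close>
    inside the region where the grid is dense.\<close>
  have norm_le: "cmod (c + t *\<^sub>R w \<phi>) \<le> t" if "\<phi> \<in> S" "6 \<le> t" for t \<phi>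
  proof -
    have "cmod c * (cmod c - 8/5 * t) \<le> 0"
      using that c by (intro mult_nonneg_nonpos) auto
    then have "(cmod (c + t *\<^sub>R w \<phi>))\<^sup>2 \<le> t\<^sup>2"
      using norm_sq[of \<phi> t] that by (simp add: power2_eq_square algebra_simps)
    then show ?thesis by (rule power2_le_imp_le) (use that in simp)
  qed
  have norm_le_dist: "cmod p \<le> cmod z + dist z p" for p z
    using norm_triangle_sub[of p z] by (simp add: dist_norm norm_minus_commute)
  have dist_y: "dist (y \<phi>) c = \<rho>" for \<phi>
    by (simp add: y_def dist_norm norm_w \<rho>_def)
  have covered: "\<exists>d\<in>C. d \<noteq> c \<and> dist (y \<phi>) d < \<rho>" if \<phi>: "\<phi> \<in> S" for \<phi>
  proof -
    obtain p where p: "p \<in> lattice_points" "dist (y \<phi>) p < 7072/10000"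
      using lattice_point_near by blast
    have "cmod p \<le> cmod (y \<phi>) + dist (y \<phi>) p"
      by (rule norm_le_dist)
    also have "\<dots> < 1442/100" using norm_le[OF \<phi>, of \<rho>] p(2) unfolding y_def \<rho>_def by simp
    finally have "p \<in> grid" using p(1) mem_gridI by blast
    then obtain d where d: "d \<in> C" "dist d p < 19/2" using cover by blast
    have "dist (y \<phi>) d < \<rho>"
      using dist_triangle2[of "y \<phi>" d p] p(2) d(2) unfolding \<rho>_def by simp
    then show ?thesis using d(1) dist_y[of \<phi>] by auto
  qed
  have separated: "3593/200 < cmod (d - c)"
    if \<phi>: "\<phi> \<in> S" and d: "d \<in> C" "d \<noteq> c" "dist (y \<phi>) d < \<rho>" for \<phi> d
  proof (rule ccontr)
    assume "\<not> ?thesis"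
    then obtain p where p: "p \<in> lattice_points" "dist d p < 19/2" "dist c p < 19/2"
      "dist ((d + c) / 2) p \<le> 9/8"
      using lens_contains_lattice_point[of d c] d(2) by auto
    \<comment> \<open>The lattice point in the lens is in the grid, as the midpoint of \<open>c\<close> and \<open>d\<close> is within \<open>\<rho>/2\<close>
      of the midpoint of \<open>c\<close> and \<open>y \<phi>\<close>.\<close>
    have "(cmod (c + (\<rho>/2) *\<^sub>R w \<phi>))\<^sup>2 \<le> (cmod c)\<^sup>2 - 8/5 * (\<rho>/2) * cmod c + (\<rho>/2)\<^sup>2"
      using norm_sq[OF \<phi>, of "\<rho>/2"] by (simp add: \<rho>_def)
    also have "\<dots> = cmod c * (cmod c - 8/5 * (\<rho>/2)) + (\<rho>/2)\<^sup>2"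
      by (simp add: power2_eq_square algebra_simps)
    also have "\<dots> \<le> cmod c * 2 + (\<rho>/2)\<^sup>2"
      using c by (intro add_right_mono mult_left_mono) (auto simp: \<rho>_def)
    also have "\<dots> \<le> 7\<^sup>2" using c by (simp add: \<rho>_def power2_eq_square)
    finally have 1: "cmod (c + (\<rho>/2) *\<^sub>R w \<phi>) \<le> 7" by (rule power2_le_imp_le) simp
    have "(d + c) / 2 = (c + (\<rho>/2) *\<^sub>R w \<phi>) + (1/2) *\<^sub>R (d - y \<phi>)"
      by (simp add: y_def complex_eq_iff field_simps)
    then have "cmod ((d + c) / 2) \<le> cmod (c + (\<rho>/2) *\<^sub>R w \<phi>) + cmod ((1/2) *\<^sub>R (d - y \<phi>))"
      by (simp only: norm_triangle_ineq)
    also have "\<dots> \<le> 7 + \<rho>/2" using 1 d(3) by (simp add: dist_norm norm_minus_commute)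
    finally have "cmod ((d + c) / 2) \<le> 7 + \<rho>/2" .
    moreover have "cmod p \<le> cmod ((d + c) / 2) + dist ((d + c) / 2) p"
      by (rule norm_le_dist)
    ultimately have "cmod p < 1442/100" using p(4) unfolding \<rho>_def by linarith
    then have "p \<in> grid" using p(1) mem_gridI by blast
    then show False using cover[of p] p c(1) d by blast
  qed
  have unique: "d = e"
    if \<phi>: "\<phi> \<in> S" and d: "d \<in> C" "d \<noteq> c" "dist (y \<phi>) d < \<rho>"
      and e: "e \<in> C" "e \<noteq> c" "dist (y \<phi>) e < \<rho>" for \<phi> d e
  proof -
    obtain p where p: "p \<in> lattice_points" "dist (c + Z *\<^sub>R w \<phi>) p < 7072/10000"
      using lattice_point_near by blast
    have "cmod p \<le> cmod (c + Z *\<^sub>R w \<phi>) + dist (c + Z *\<^sub>R w \<phi>) p"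
      by (rule norm_le_dist)
    also have "\<dots> < 1442/100" using norm_le[OF \<phi>, of Z] p(2) unfolding Z_def by simp
    finally have "p \<in> grid" using p(1) mem_gridI by blast
    moreover have "dist x p < 19/2" if x: "x \<in> C" "x \<noteq> c" "dist (y \<phi>) x < \<rho>" for x
    proof -
      have "dist (x - c) (\<rho> *\<^sub>R w \<phi>) < \<rho>"
        using x(3) by (simp add: y_def dist_norm norm_minus_commute algebra_simps)
      then have "dist (x - c) (Z *\<^sub>R w \<phi>) < 87928/10000"
        using disk_beyond_tangent_forced[OF norm_w separated[OF \<phi> x]] unfolding \<rho>_def Z_def by simp
      moreover have "dist (x - c) (Z *\<^sub>R w \<phi>) = dist x (c + Z *\<^sub>R w \<phi>)"
        by (simp add: dist_norm algebra_simps)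
      ultimately show ?thesis
        using dist_triangle[of x p "c + Z *\<^sub>R w \<phi>"] p(2) by simp
    qed
    ultimately show ?thesis using cover[of p] d e by blast
  qed
  have "0 \<in> S" by (simp add: S_def)
  then obtain d where d: "d \<in> C" "d \<noteq> c" "dist (y 0) d < \<rho>" using covered by blast
  \<comment> \<open>The disks around \<open>d\<close> and around all other centres separate the arc into two open parts, the
    first of which is nonempty.\<close>
  have "connected (y ` S)"
    unfolding S_def y_def w_def
    by (intro connected_continuous_image continuous_intros connected_Icc)
  moreover have "open (\<Union>e\<in>C - {c, d}. ball e \<rho>)" by auto
  moreover have arc_covered: "y ` S \<subseteq> ball d \<rho> \<union> (\<Union>e\<in>C - {c, d}. ball e \<rho>)"
    using covered by (fastforce simp: dist_commute)
  moreover have "ball d \<rho> \<inter> (\<Union>e\<in>C - {c, d}. ball e \<rho>) \<inter> y ` S = {}"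
  proof -
    have "e = d" if "\<phi> \<in> S" "dist d (y \<phi>) < \<rho>" "e \<in> C" "e \<noteq> c" "dist e (y \<phi>) < \<rho>" for \<phi> e
      using unique[of \<phi> e d] that d by (simp add: dist_commute)
    then show ?thesis by auto
  qed
  moreover have "ball d \<rho> \<inter> y ` S \<noteq> {}" using d \<open>0 \<in> S\<close> by (auto simp: dist_commute)
  ultimately have others: "(\<Union>e\<in>C - {c, d}. ball e \<rho>) \<inter> y ` S = {}"
    using connectedD[of "y ` S" "ball d \<rho>"] by blast
  then have near: "dist (y \<phi>) d < \<rho>" if "\<phi> \<in> S" for \<phi>
  proof -
    have "y \<phi> \<in> ball d \<rho>"
      using that arc_covered others by blast
    then show ?thesis by (simp add: dist_commute)
  qed
  \<comment> \<open>The two ends of the arc alone show that \<open>d\<close> is too close to \<open>c\<close>.\<close>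
  define a where "a = d - c"
  have a2: "(cmod a)\<^sup>2 < 2 * \<rho> * (a \<bullet> w \<phi>)" if "\<phi> \<in> S" for \<phi>
  proof -
    have "(norm (a - \<rho> *\<^sub>R w \<phi>))\<^sup>2 < \<rho>\<^sup>2"
      using near[OF that] by (intro power_strict_mono)
        (auto simp: a_def y_def dist_norm norm_minus_commute algebra_simps)
    then show ?thesis
      using norm_add_scaleR_unit_squared[OF norm_w, of a "- \<rho>" \<phi>] by simp
  qed
  have ends: "pi/6 \<in> S" "- pi/6 \<in> S" by (simp_all add: S_def)
  have "w (pi/6) + w (- pi/6) = sqrt 3 *\<^sub>R u"
    by (simp add: w_def complex_eq_iff cos_30 sin_30 algebra_simps)
  then have "a \<bullet> w (pi/6) + a \<bullet> w (- pi/6) = sqrt 3 * (a \<bullet> u)"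
    by (metis inner_add_right inner_scaleR_right)
  moreover have "a \<bullet> u \<le> cmod a" using norm_cauchy_schwarz[of a u] u by simp
  then have "sqrt 3 * (a \<bullet> u) \<le> sqrt 3 * cmod a" by simp
  ultimately have "2 * (cmod a)\<^sup>2 < 2 * \<rho> * (sqrt 3 * cmod a)"
    using a2[OF ends(1)] a2[OF ends(2)] unfolding \<rho>_def by linarith
  moreover have a: "3593/200 < cmod a" using separated[OF \<open>0 \<in> S\<close> d] by (simp add: a_def)
  ultimately have "cmod a * cmod a < (\<rho> * sqrt 3) * cmod a" by (simp add: power2_eq_square)
  then have "cmod a < \<rho> * sqrt 3" by (rule mult_right_less_imp_less) simp
  also have "\<dots> < \<rho> * (7/4)"
    by (intro mult_strict_left_mono real_less_lsqrt) (auto simp: \<rho>_def power2_eq_square)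
  finally show False using a unfolding \<rho>_def by simp
qed

section \<open>Transfer to unit disks in the plane\<close>

definition scaled_point :: "complex \<Rightarrow> real^2" where
  "scaled_point z = (2/19) *\<^sub>R vector [Re z, Im z]"

lemma dist_scaled_point: "dist (scaled_point z) (scaled_point z') = 2/19 * dist z z'"
proof -
  have "(vector [Re z, Im z] - vector [Re z', Im z'] :: real^2) = vector [Re (z - z'), Im (z - z')]"
    by (simp add: vec_eq_iff forall_2)
  then have "dist (scaled_point z) (scaled_point z') =
      2/19 * norm (vector [Re (z - z'), Im (z - z')] :: real^2)"
    unfolding scaled_point_def dist_norm by (simp add: scaleR_diff_right[symmetric])
  then show ?thesis by (simp add: dist_norm norm_vec_def L2_set_def sum_2 cmod_def)
qed

lemma inj_scaled_point: "inj scaled_point"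
proof (rule injI)
  fix z z' assume "scaled_point z = scaled_point z'"
  then show "z = z'" using dist_scaled_point[of z z'] by simp
qed

lemma surj_scaled_point: "surj scaled_point"
proof (rule surjI)
  fix x :: "real^2"
  show "scaled_point (Complex (19/2 * x $ 1) (19/2 * x $ 2)) = x"
    by (simp add: scaled_point_def vec_eq_iff forall_2)
qed

text \<open>Exact covers restrict to subsets, so it does not matter with which points the grid is filled up
  to \<open>n\<close> points.\<close>

lemma not_all_exactly_coverable:
  assumes "657 \<le> n"
  shows "\<not> all_exactly_coverable n"
proof
  assume cov: "all_exactly_coverable n"
  have fin: "finite (scaled_point ` grid)" using card_grid(1) by simp
  have "card (scaled_point ` grid) \<le> n"
    using card_image_le[OF card_grid(1), of scaled_point] card_grid(2) assms by linarith
  moreover have "infinite (UNIV - scaled_point ` grid)"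
    using fin infinite_UNIV_char_0 by (rule Diff_infinite_finite)
  then obtain Y where Y: "finite Y" "card Y = n - card (scaled_point ` grid)"
      "Y \<subseteq> UNIV - scaled_point ` grid"
    using infinite_arbitrarily_large by blast
  define X where "X = scaled_point ` grid \<union> Y"
  have "card X = card (scaled_point ` grid) + card Y"
    unfolding X_def using fin Y by (intro card_Un_disjoint) auto
  ultimately have X: "finite X" "card X = n" "scaled_point ` grid \<subseteq> X"
    using fin Y by (auto simp: X_def)
  obtain \<D> where D: "\<D> \<subseteq> range unit_disk" "\<forall>x\<in>X. \<exists>!D. D \<in> \<D> \<and> x \<in> D"
    using cov[unfolded all_exactly_coverable_def, rule_format, of X] X
    unfolding exact_cover_def by auto
  define C where "C = {z. unit_disk (scaled_point z) \<in> \<D>}"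
  have mem: "scaled_point p \<in> unit_disk (scaled_point z) \<longleftrightarrow> dist z p < 19/2" for z p
    unfolding unit_disk_def mem_ball dist_scaled_point by linarith
  have inj: "z = z'" if "unit_disk (scaled_point z) = unit_disk (scaled_point z')" for z z'
    using that inj_scaled_point by (simp add: unit_disk_def ball_eq_ball_iff inj_eq)
  show False
  proof (rule grid_not_exactly_covered)
    fix p assume "p \<in> grid"
    then have ex: "\<exists>!D. D \<in> \<D> \<and> scaled_point p \<in> D" using D(2) X(3) by blast
    then obtain D where "D \<in> \<D>" "scaled_point p \<in> D" by blast
    moreover then obtain z where "D = unit_disk (scaled_point z)"
      using D(1) surj_scaled_point by (metis image_iff subsetD surjD)
    ultimately have "z \<in> C \<and> dist z p < 19/2" using mem by (simp add: C_def)
    moreover have "z' = z" if "z' \<in> C \<and> dist z' p < 19/2" for z'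
      using that calculation ex mem inj unfolding C_def by blast
    ultimately show "\<exists>!z. z \<in> C \<and> dist z p < 19/2" by blast
  qed
qed

theorem theorem1p3:
  shows "all_exactly_coverable sigma_hat_2 \<and>
         (\<forall>n. all_exactly_coverable n \<longrightarrow> n \<le> sigma_hat_2) \<and>
         sigma_hat_2 < 657"
proof -
  have bound: "n < 657" if "all_exactly_coverable n" for n
    using that not_all_exactly_coverable[of n] by linarith
  have zero: "all_exactly_coverable 0"
    by (auto simp: all_exactly_coverable_def exact_cover_def)
  have "all_exactly_coverable sigma_hat_2"
    unfolding sigma_hat_2_def by (rule GreatestI_nat[where k = 0 and b = 657]) (use zero bound in force)+
  moreover have "n \<le> sigma_hat_2" if "all_exactly_coverable n" for n
    unfolding sigma_hat_2_def by (rule Greatest_le_nat[where b = 657]) (use that bound in force)+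
  ultimately show ?thesis using bound by blast
qed

end
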